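(* Let $X$ be a Banach space and let $\{\varphi_t : X\to X \mid t\ge 0\}$ be a bounded semigroup of linear operators such that for each $v\in X$ the function $t\mapsto \varphi_t(v)$ is continuous for $t>0$. Let $X_0=\{x\in X\mid \varphi_t(x)\to 0 \text{ as } t\to\infty\}$ and suppose that $\operatorname{codim} X_0=n<\infty$. Let $Y\subset X$ be an $n$-dimensional subspace such that $X_0\oplus Y=X$, and write $Y_t=\varphi_t(Y)$. If $Y$ is not stabilizable, then $$\sum_{k=1}^{\infty}\angle(Y_{k+1},Y_k)=\infty .$$
   Context: A semigroup means $\varphi_t\circ\varphi_q=\varphi_{t+q}$ for all $t,q\ge 0$; it is bounded if there is a constant $C<\infty$ with $\|\varphi_t\|\le C$ for all $t\ge 0$. For subspaces $A,B\subset X$ the angle is $$\angle(A,B)=\min\Bigl\{\sup_{a\in A,\,|a|=1}\rho(a,B),\ \sup_{b\in B,\,|b|=1}\rho(b,A)\Bigr\},$$ where $\rho(v,A)$ denotes the distance from the vector $v$ to the subspace $A$. The subspace $Y$ is stabilizable if there is a limit position, i.e. an $n$-dimensional subspace $Y_\infty\subset X$ with $\angle(Y_t,Y_\infty)\to 0$ as $t\to\infty$. *)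

theory Defs
  imports "HOL-Analysis.Analysis"
begin

(* Unlike "dim Y = n", this excludes infinite-dimensional Y when n = 0. *)
definition subspace_of_dim :: "nat \<Rightarrow> 'a::real_vector set \<Rightarrow> bool" where
  "subspace_of_dim n Y \<longleftrightarrow> (\<exists>B. finite B \<and> card B = n \<and> independent B \<and> span B = Y)"

(* S is a subspace and the quotient by S has dimension n: the cosets of the
   elements of B form a basis of the quotient. *)
definition has_codim :: "'a::real_vector set \<Rightarrow> nat \<Rightarrow> bool" where
  "has_codim S n \<longleftrightarrow> subspace S \<and>
     (\<exists>B. finite B \<and> card B = n \<and>
        (\<forall>c. (\<Sum>b\<in>B. c b *\<^sub>R b) \<in> S \<longrightarrow> (\<forall>b\<in>B. c b = 0)) \<and>
        span (B \<union> S) = UNIV)"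

definition direct_sum :: "'a::real_vector set \<Rightarrow> 'a set \<Rightarrow> bool" where
  "direct_sum A B \<longleftrightarrow> subspace A \<and> subspace B \<and>
     A \<inter> B = {0} \<and> {a + b | a b. a \<in> A \<and> b \<in> B} = UNIV"

(* Inserting 0 makes the supremum 0 when A = {0}; otherwise it changes nothing. *)
definition max_dist :: "'a::real_normed_vector set \<Rightarrow> 'a set \<Rightarrow> real" where
  "max_dist A B = Sup (insert 0 ((\<lambda>a. infdist a B) ` {a \<in> A. norm a = 1}))"

definition angle :: "'a::real_normed_vector set \<Rightarrow> 'a set \<Rightarrow> real" where
  "angle A B = min (max_dist A B) (max_dist B A)"

(* Only times t \<ge> 0 matter, and \<phi> 0 need not be the identity. *)
definition bounded_semigroup :: "(real \<Rightarrow> 'a::real_normed_vector \<Rightarrow>\<^sub>L 'a) \<Rightarrow> bool" where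
  "bounded_semigroup \<phi> \<longleftrightarrow>
     (\<forall>t\<ge>0. \<forall>q\<ge>0. \<phi> t o\<^sub>L \<phi> q = \<phi> (t + q)) \<and>
     (\<exists>C. \<forall>t\<ge>0. norm (\<phi> t) \<le> C)"

definition null_space :: "(real \<Rightarrow> 'a::real_normed_vector \<Rightarrow>\<^sub>L 'a) \<Rightarrow> 'a set" where
  "null_space \<phi> = {x. ((\<lambda>t. blinfun_apply (\<phi> t) x) \<longlongrightarrow> 0) at_top}"

definition stabilizable ::
  "(real \<Rightarrow> 'a::real_normed_vector \<Rightarrow>\<^sub>L 'a) \<Rightarrow> nat \<Rightarrow> 'a set \<Rightarrow> bool" where
  "stabilizable \<phi> n Y \<longleftrightarrow>
     (\<exists>Z. subspace_of_dim n Z \<and>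
        ((\<lambda>t. angle (blinfun_apply (\<phi> t) ` Y) Z) \<longlongrightarrow> 0) at_top)"

end

theory Submission
  imports Defs
begin

text \<open>
  Suppose the sums of angles do not diverge; being increasing, they converge, and a limit position
  has to be constructed. Write \<open>X0\<close> for the space of vectors whose orbits tend to 0 and \<open>Y\<^sub>t\<close> for
  \<open>\<phi> t ` Y\<close>.

  Boundedness of the semigroup and finite dimension of \<open>Y\<close> give \<open>m > 0\<close> such that
  \<open>norm (\<phi> t y) \<ge> m * norm y\<close> for all \<open>t \<ge> 0\<close> and \<open>y \<in> Y\<close>. Consequently every \<open>Y\<^sub>t\<close> is a complement of
  \<open>X0\<close>, uniformly transversal to it (lemma \<open>transversality\<close>), and the projections \<open>Q t\<close> onto \<open>Y\<^sub>t\<close>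
  along \<open>X0\<close> are bounded by one constant. The common kernel gives \<open>Q s \<circ> Q t = Q s\<close> and
  \<open>\<phi> s \<circ> Q t = Q (s + t) \<circ> \<phi> s\<close>, and with it the key estimate
  \<open>norm (Q s x - Q t x) \<le> K * angle Y\<^sub>s Y\<^sub>t * norm x\<close> (lemma \<open>Q_diff_le_angle\<close>), where the angle is
  the smaller of the two one-sided distances.

  Summability of the angles therefore makes the \<open>Q k\<close>, \<open>k\<close> a natural number, converge in the
  operator norm to a projection \<open>L\<close> with kernel \<open>X0\<close>, and \<open>L\<close> commutes with \<open>\<phi> k\<close>. The remaining
  point is that \<open>Z = range L\<close> is invariant at fractional times as well. The commutator
  \<open>D = \<phi> s \<circ> L - L \<circ> \<phi> s\<close> has values in \<open>X0\<close>, vanishes on \<open>X0\<close> and commutes with every \<open>\<phi> k\<close>. Modulo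
  \<open>X0\<close> every vector has preimages under \<open>\<phi> k\<close> in \<open>Y\<close> that are bounded as \<open>k\<close> grows, whereas
  \<open>\<phi> k\<close> tends to 0 on \<open>D ` Y\<close>; this forces \<open>D = 0\<close> (lemma \<open>commuting_defect_zero\<close>). Now
  \<open>Y\<^sub>t = \<phi> s ` Y\<^sub>k\<close> is as close to \<open>Z = L ` Y\<close> as \<open>Y\<^sub>k\<close> is, up to a constant factor, for every \<open>s\<close>
  between 0 and 1, and \<open>Z\<close> is the limit position.
\<close>

section \<open>Finite-dimensional subspaces and one-sided distances\<close>

text \<open>
  Compactness of the set of coordinate vectors with \<open>\<Sum>\<bar>c b\<bar> = 1\<close> replaces compactness of the unit
  sphere of \<open>span B\<close>. The dimension is a variable number, so the coordinate vectors live in the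
  function space over the whole type, whose product topology makes the box compact by Tychonoff;
  coordinates outside \<open>B\<close> are pinned to 0. The function \<open>q\<close> is not taken to be a norm because the
  intended instance is the infimum of the norms along an orbit, which need not be subadditive.
\<close>
lemma coordinate_lower_bound:
  fixes B :: "'a::real_normed_vector set" and q :: "'a \<Rightarrow> real"
  assumes "finite B" "independent B" "continuous_on UNIV q"
    and scale: "\<And>r x. q (r *\<^sub>R x) = \<bar>r\<bar> * q x"
    and pos: "\<And>x. x \<in> span B \<Longrightarrow> x \<noteq> 0 \<Longrightarrow> q x > 0"
  shows "\<exists>m>0. \<forall>c. m * (\<Sum>b\<in>B. \<bar>c b\<bar>) \<le> q (\<Sum>b\<in>B. c b *\<^sub>R b)"
proof -
  define box where "box = (\<Pi>\<^sub>E b\<in>UNIV. if b \<in> B then {-1..1} else {0::real})"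
  define K where "K = box \<inter> {c. (\<Sum>b\<in>B. \<bar>c b\<bar>) = 1}"
  define f where "f c = q (\<Sum>b\<in>B. c b *\<^sub>R b)" for c :: "'a \<Rightarrow> real"
  have coord: "continuous_on UNIV (\<lambda>c. c b)" for b :: 'a
    by (rule continuous_on_product_coordinates)
  have "compactin (product_topology (\<lambda>b::'a. euclidean) UNIV) box"
    unfolding box_def by (subst compactin_PiE) auto
  then have "compact box"
    by (simp add: euclidean_product_topology)
  moreover have "closed {c::'a \<Rightarrow> real. (\<Sum>b\<in>B. \<bar>c b\<bar>) = 1}"
    by (intro closed_Collect_eq continuous_intros coord)
  ultimately have K: "compact K"
    unfolding K_def by (rule compact_Int_closed)
  have "continuous_on UNIV (q \<circ> (\<lambda>c. \<Sum>b\<in>B. c b *\<^sub>R b))"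
    by (intro continuous_on_compose continuous_intros coord continuous_on_subset[OF assms(3)] subset_UNIV)
  then have f: "continuous_on K f"
    unfolding f_def comp_def by (rule continuous_on_subset) simp
  have fpos: "f c > 0" if "c \<in> K" for c
  proof -
    have "(\<Sum>b\<in>B. c b *\<^sub>R b) \<noteq> 0"
    proof
      assume "(\<Sum>b\<in>B. c b *\<^sub>R b) = 0"
      then have "\<forall>b\<in>B. c b = 0"
        using assms(1,2) independent_explicit_finite_subsets by blast
      then show False using that by (simp add: K_def)
    qed
    moreover have "(\<Sum>b\<in>B. c b *\<^sub>R b) \<in> span B"
      by (intro span_sum span_scale span_base)
    ultimately show ?thesis unfolding f_def by (rule pos[rotated])
  qed
  obtain m where m: "m > 0" "\<And>c. c \<in> K \<Longrightarrow> m \<le> f c"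
  proof (cases "K = {}")
    case True
    then show ?thesis using that[of 1] by auto
  next
    case False
    then obtain c where "c \<in> K" "\<And>d. d \<in> K \<Longrightarrow> f c \<le> f d"
      using continuous_attains_inf[OF K _ f] by auto
    then show ?thesis using that fpos by blast
  qed
  have "m * (\<Sum>b\<in>B. \<bar>c b\<bar>) \<le> f c" for c
  proof (cases "(\<Sum>b\<in>B. \<bar>c b\<bar>) = 0")
    case True
    then have "\<forall>b\<in>B. c b = 0"
      using assms(1) by (simp add: sum_nonneg_eq_0_iff)
    moreover have "q 0 = 0" using scale[of 0 0] by simp
    ultimately show ?thesis by (simp add: f_def)
  next
    case False
    define s where "s = (\<Sum>b\<in>B. \<bar>c b\<bar>)"
    define d where "d b = (if b \<in> B then c b / s else 0)" for b
    have s: "s > 0" using False unfolding s_def by (simp add: order_less_le sum_nonneg)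
    have le: "\<bar>c b\<bar> \<le> s" if "b \<in> B" for b
      unfolding s_def using that assms(1) by (intro member_le_sum) auto
    have "-1 \<le> c b / s \<and> c b / s \<le> 1" if "b \<in> B" for b
      using le[OF that] s by (auto simp: field_simps abs_le_iff)
    then have "d \<in> box" by (auto simp: box_def d_def)
    moreover have "(\<Sum>b\<in>B. \<bar>d b\<bar>) = 1"
    proof -
      have "(\<Sum>b\<in>B. \<bar>d b\<bar>) = (\<Sum>b\<in>B. \<bar>c b\<bar> / s)"
        using s by (intro sum.cong) (auto simp: d_def)
      also have "\<dots> = 1" using s by (simp add: sum_divide_distrib[symmetric] s_def[symmetric])
      finally show ?thesis .
    qed
    ultimately have "m \<le> f d" using m(2) by (simp add: K_def)
    moreover have "f c = s * f d"
    proof -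
      have "(\<Sum>b\<in>B. c b *\<^sub>R b) = s *\<^sub>R (\<Sum>b\<in>B. d b *\<^sub>R b)"
        unfolding scaleR_sum_right using s by (intro sum.cong) (auto simp: d_def)
      then show ?thesis using s by (simp add: f_def scale)
    qed
    ultimately show ?thesis using s by (simp add: s_def[symmetric] mult.commute)
  qed
  then show ?thesis using m(1) unfolding f_def by blast
qed

lemma direct_sum_projection:
  fixes A B :: "'a::real_vector set"
  assumes "direct_sum A B"
  obtains P :: "'a \<Rightarrow> 'a" where "linear P" "\<And>x. P x \<in> B" "\<And>x. x - P x \<in> A"
proof -
  have A: "subspace A" and B: "subspace B" and AB: "A \<inter> B = {0}"
    and all: "x \<in> {a + b | a b. a \<in> A \<and> b \<in> B}" for x
    using assms unfolding direct_sum_def by simp_all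
  define P where "P x = (SOME b. b \<in> B \<and> x - b \<in> A)" for x
  have "\<exists>b. b \<in> B \<and> x - b \<in> A" for x using all[of x] by force
  then have P: "P x \<in> B \<and> x - P x \<in> A" for x
    unfolding P_def by (rule someI_ex)
  have uniq: "P x = b" if "b \<in> B" "x - b \<in> A" for x b
  proof -
    have "P x - b \<in> B" using P that B by (simp add: subspace_diff)
    moreover have "(x - b) - (x - P x) \<in> A" using subspace_diff[OF A, of "x - b" "x - P x"] P that by blast
    then have "P x - b \<in> A" by simp
    ultimately have "P x - b \<in> A \<inter> B" by blast
    then show ?thesis unfolding AB by simp
  qed
  have "linear P"
  proof
    fix x y r
    have "(x - P x) + (y - P y) \<in> A" using P A subspace_add by blast
    then show "P (x + y) = P x + P y"
      using P B by (intro uniq) (auto simp: subspace_add algebra_simps)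
    have "r *\<^sub>R (x - P x) \<in> A" using P A subspace_scale by blast
    then show "P (r *\<^sub>R x) = r *\<^sub>R P x"
      using P B by (intro uniq) (auto simp: subspace_scale algebra_simps)
  qed
  then show ?thesis using P that by blast
qed

lemma bdd_above_infdist_sphere:
  fixes B :: "'a::real_normed_vector set"
  assumes "subspace B"
  shows "bdd_above (insert 0 ((\<lambda>a. infdist a B) ` {a \<in> A. norm a = 1}))"
proof -
  have "infdist a B \<le> 1" if "norm a = 1" for a
    using infdist_le[OF subspace_0[OF assms], of a] that by simp
  then show ?thesis by (intro bdd_aboveI[of _ 1]) auto
qed

lemma infdist_le_max_dist:
  assumes "subspace A" "subspace B" "a \<in> (A :: 'a::real_normed_vector set)"
  shows "infdist a B \<le> max_dist A B * norm a"
proof (cases "a = 0")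
  case True
  then show ?thesis using subspace_0[OF assms(2)] by simp
next
  case False
  define u where "u = a /\<^sub>R norm a"
  have u: "u \<in> A" "norm u = 1" using False assms by (auto simp: u_def subspace_scale)
  have "infdist u B \<le> max_dist A B"
    unfolding max_dist_def using u
    by (intro cSup_upper bdd_above_infdist_sphere[OF assms(2)]) auto
  moreover have "infdist a B / norm a \<le> infdist u B"
  proof -
    have "infdist a B / norm a \<le> dist u b" if "b \<in> B" for b
    proof -
      have "infdist a B \<le> dist a (norm a *\<^sub>R b)"
        using that assms by (intro infdist_le subspace_scale)
      also have "a - norm a *\<^sub>R b = norm a *\<^sub>R (u - b)"
        using False by (simp add: u_def algebra_simps)
      then have "dist a (norm a *\<^sub>R b) = norm a * dist u b" by (simp add: dist_norm)
      finally show ?thesis using False by (simp add: field_simps)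
    qed
    moreover have "B \<noteq> {}" using subspace_0[OF assms(2)] by auto
    ultimately show ?thesis unfolding infdist_def by (auto intro: cINF_greatest)
  qed
  ultimately have "infdist a B / norm a \<le> max_dist A B" by simp
  then show ?thesis using False by (simp add: pos_divide_le_eq)
qed

lemma max_dist_nonneg: "subspace B \<Longrightarrow> 0 \<le> max_dist A B"
  unfolding max_dist_def by (intro cSup_upper bdd_above_infdist_sphere) auto

lemma max_dist_le:
  assumes "0 \<le> e" "\<And>a. a \<in> A \<Longrightarrow> norm a = 1 \<Longrightarrow> \<exists>b\<in>B. norm (a - b) \<le> e"
  shows "max_dist A (B :: 'a::real_normed_vector set) \<le> e"
  unfolding max_dist_def
proof (rule cSup_least)
  fix r assume "r \<in> insert 0 ((\<lambda>a. infdist a B) ` {a \<in> A. norm a = 1})"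
  then show "r \<le> e"
    using assms by (fastforce simp: dist_norm intro: infdist_le2)
qed auto

lemma incseq_convergent_or_at_top:
  fixes S :: "nat \<Rightarrow> real"
  assumes "incseq S" "\<not> filterlim S at_top sequentially"
  obtains l where "S \<longlonglongrightarrow> l" "\<And>n. S n \<le> l"
proof -
  obtain Z where Z: "\<not> eventually (\<lambda>n. Z \<le> S n) sequentially"
    using assms(2) unfolding filterlim_at_top by blast
  have "S n \<le> Z" for n
  proof (rule ccontr)
    assume "\<not> S n \<le> Z"
    then have "\<forall>k\<ge>n. Z \<le> S k" using assms(1) by (meson incseqD less_imp_le not_less order_trans)
    with Z show False by (auto simp: eventually_sequentially)
  qed
  then show ?thesis using incseq_convergent[OF assms(1)] that by blast
qed

text \<open>
  If the image missed a vector of \<open>span B\<close>, that vector together with \<open>T ` B\<close> would be an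
  independent set of \<open>card B + 1\<close> elements inside \<open>span B\<close>.
\<close>
lemma independent_image_spans:
  assumes "finite B" "independent B" "linear T" "inj_on T (span B)" "T ` span B \<subseteq> span B"
  shows "T ` span B = span (B :: 'a::real_vector set)"
proof -
  have ind: "independent (T ` B)"
    by (intro linear_independent_injective_image assms)
  have card: "card (T ` B) = card B"
    using assms(4) span_superset by (metis card_image inj_on_subset)
  have sub: "T ` B \<subseteq> span B" using assms(5) span_superset by blast
  have "span B \<subseteq> span (T ` B)"
  proof
    fix x assume x: "x \<in> span B"
    show "x \<in> span (T ` B)"
    proof (rule ccontr)
      assume nx: "x \<notin> span (T ` B)"
      then have "independent (insert x (T ` B))" using ind by (simp add: independent_insert)
      moreover have "insert x (T ` B) \<subseteq> span B" using x sub by simp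
      ultimately have "card (insert x (T ` B)) \<le> card B"
        using independent_span_bound[OF assms(1)] by blast
      moreover have "x \<notin> T ` B" using nx by (metis span_base)
      ultimately show False using assms(1) card by simp
    qed
  qed
  then show ?thesis using assms(3,5) by (simp add: linear_span_image subset_antisym)
qed

section \<open>Bounded semigroups with a finite-dimensional complement\<close>

text \<open>
  The basis \<open>B\<close> of the complement and a positive bound \<open>C\<close> are parameters, so that coordinates and
  constants can be named.
\<close>
locale complemented_semigroup =
  fixes \<phi> :: "real \<Rightarrow> 'a::banach \<Rightarrow>\<^sub>L 'a" and B :: "'a set" and C :: real
  assumes semigroup: "\<And>s t x. s \<ge> 0 \<Longrightarrow> t \<ge> 0 \<Longrightarrow> \<phi> (s + t) x = \<phi> s (\<phi> t x)"
    and C_pos: "C > 0"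
    and bound: "\<And>t x. t \<ge> 0 \<Longrightarrow> norm (\<phi> t x) \<le> C * norm x"
    and fin: "finite B" and ind: "independent B"
    and sum: "direct_sum (null_space \<phi>) (span B)"
begin

abbreviation X0 :: "'a set" where "X0 \<equiv> null_space \<phi>"
abbreviation Yt :: "real \<Rightarrow> 'a set" where "Yt t \<equiv> \<phi> t ` span B"

lemma subspace_X0: "subspace X0" and X0_inter: "X0 \<inter> span B = {0}"
  using sum by (auto simp: direct_sum_def)

lemma X0D: "x \<in> X0 \<Longrightarrow> ((\<lambda>t. \<phi> t x) \<longlongrightarrow> 0) at_top"
  by (simp add: null_space_def)

text \<open>
  A bounded semigroup cannot let an orbit that was once small grow large again.
\<close>
lemma X0_of_small_orbit:
  assumes "\<And>e. e > 0 \<Longrightarrow> \<exists>t\<ge>0. norm (\<phi> t x) < e"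
  shows "x \<in> X0"
proof -
  have "\<forall>\<^sub>F t in at_top. norm (\<phi> t x) < e" if e: "e > 0" for e
  proof -
    obtain t where t: "t \<ge> 0" "norm (\<phi> t x) < e / C"
      using assms[of "e / C"] e C_pos by auto
    have "norm (\<phi> s x) < e" if "s \<ge> t" for s
    proof -
      have "\<phi> s x = \<phi> (s - t) (\<phi> t x)"
        using semigroup[of "s - t" t x] t that by simp
      then have "norm (\<phi> s x) \<le> C * norm (\<phi> t x)"
        using bound[of "s - t"] that by simp
      also have "\<dots> < e" using t(2) C_pos by (simp add: field_simps)
      finally show ?thesis .
    qed
    then show ?thesis by (auto simp: eventually_at_top_linorder)
  qed
  then show ?thesis by (simp add: null_space_def tendsto_iff)
qed

lemma X0_invariant: "t \<ge> 0 \<Longrightarrow> \<phi> t x \<in> X0 \<longleftrightarrow> x \<in> X0"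
proof
  assume t: "t \<ge> 0" and x: "\<phi> t x \<in> X0"
  show "x \<in> X0"
  proof (rule X0_of_small_orbit)
    fix e :: real assume "e > 0"
    with X0D[OF x] have "\<forall>\<^sub>F s in at_top. norm (\<phi> s (\<phi> t x)) < e"
      by (simp add: tendsto_iff)
    then obtain s where "s \<ge> 0" "norm (\<phi> s (\<phi> t x)) < e"
      unfolding eventually_at_top_linorder by (meson max.cobounded1 max.cobounded2)
    then show "\<exists>t\<ge>0. norm (\<phi> t x) < e"
      using semigroup t by (metis add_nonneg_nonneg)
  qed
next
  assume t: "t \<ge> 0" and x: "x \<in> X0"
  have "((\<lambda>s. \<phi> t (\<phi> s x)) \<longlongrightarrow> \<phi> t 0) at_top"
    by (intro tendsto_intros X0D[OF x])
  moreover have "\<forall>\<^sub>F s in at_top. \<phi> t (\<phi> s x) = \<phi> s (\<phi> t x)"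
    using eventually_ge_at_top[of 0]
    by eventually_elim (metis semigroup t add.commute)
  ultimately show "\<phi> t x \<in> X0"
    by (simp add: null_space_def tendsto_cong)
qed

text \<open>
  An orbit starting in \<open>span B - {0}\<close> stays away from 0, since otherwise its starting point would
  be in \<open>X0\<close>; compactness makes the distance uniform. Here \<open>q x\<close> is the infimum of the norms
  along the orbit of \<open>x\<close>. The bound is kept in coordinates because it also yields the continuity
  of the coordinate functionals in \<open>bounded_coordinates\<close>.
\<close>
lemma orbit_lower_bound:
  "\<exists>m>0. \<forall>t\<ge>0. \<forall>c. m * (\<Sum>b\<in>B. \<bar>c b\<bar>) \<le> norm (\<phi> t (\<Sum>b\<in>B. c b *\<^sub>R b))"
proof -
  define q where "q x = (INF t\<in>{0..}. norm (\<phi> t x))" for x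
  have bdd: "bdd_below ((\<lambda>t. norm (\<phi> t x)) ` {0..})" for x
    by (rule bdd_belowI[of _ 0]) auto
  have q_le: "q x \<le> norm (\<phi> t x)" if "t \<ge> 0" for t x
    unfolding q_def by (rule cINF_lower[OF bdd]) (use that in auto)
  have le_q: "r \<le> q x" if "\<And>t. t \<ge> 0 \<Longrightarrow> r \<le> norm (\<phi> t x)" for r x
    unfolding q_def by (rule cINF_greatest) (use that in auto)
  have lip: "q x - C * norm (x - y) \<le> q y" for x y
  proof (rule le_q)
    fix t :: real assume t: "t \<ge> 0"
    have "norm (\<phi> t x) \<le> norm (\<phi> t y) + norm (\<phi> t (x - y))"
      by (metis blinfun.diff_right norm_triangle_sub)
    then show "q x - C * norm (x - y) \<le> norm (\<phi> t y)"
      using q_le[OF t, of x] bound[OF t, of "x - y"] by linarith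
  qed
  have "C-lipschitz_on UNIV q"
  proof (rule lipschitz_onI)
    fix x y
    show "dist (q x) (q y) \<le> C * dist x y"
      using lip[of x y] lip[of y x] by (simp add: dist_real_def dist_norm norm_minus_commute abs_le_iff)
  qed (use C_pos in simp)
  then have "continuous_on UNIV q" by (rule lipschitz_on_continuous_on)
  moreover have "q (r *\<^sub>R x) = \<bar>r\<bar> * q x" for r x
  proof (cases "r = 0")
    case True
    have "q 0 \<le> 0" using q_le[of 0 0] by simp
    moreover have "0 \<le> q 0" by (rule le_q) simp
    ultimately show ?thesis using True by simp
  next
    case False
    have "q (r *\<^sub>R x) / \<bar>r\<bar> \<le> q x"
    proof (rule le_q)
      fix t :: real assume "t \<ge> 0"
      then have "q (r *\<^sub>R x) \<le> norm (\<phi> t x) * \<bar>r\<bar>"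
        using q_le[of t "r *\<^sub>R x"] by (simp add: blinfun.scaleR_right mult.commute)
      then show "q (r *\<^sub>R x) / \<bar>r\<bar> \<le> norm (\<phi> t x)"
        using False by (simp add: pos_divide_le_eq)
    qed
    moreover have "\<bar>r\<bar> * q x \<le> q (r *\<^sub>R x)"
      by (rule le_q) (simp add: blinfun.scaleR_right mult_left_mono q_le)
    ultimately show ?thesis using False by (simp add: pos_divide_le_eq mult.commute)
  qed
  moreover have "q x > 0" if x: "x \<in> span B" "x \<noteq> 0" for x
  proof -
    have "x \<notin> X0" using X0_inter x by auto
    then obtain e where "e > 0" "\<And>t. t \<ge> 0 \<Longrightarrow> e \<le> norm (\<phi> t x)"
      using X0_of_small_orbit by (meson not_less)
    then show ?thesis using le_q by (meson less_le_trans)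
  qed
  ultimately obtain m where "m > 0" "\<And>c. m * (\<Sum>b\<in>B. \<bar>c b\<bar>) \<le> q (\<Sum>b\<in>B. c b *\<^sub>R b)"
    using coordinate_lower_bound[OF fin ind, of q] by blast
  then show ?thesis using q_le by (meson order_trans)
qed

lemma orbit_lower_bound_norm: "\<exists>m>0. \<forall>t\<ge>0. \<forall>y\<in>span B. m * norm y \<le> norm (\<phi> t y)"
proof -
  obtain m where m: "m > 0" "\<And>t c. t \<ge> 0 \<Longrightarrow> m * (\<Sum>b\<in>B. \<bar>c b\<bar>) \<le> norm (\<phi> t (\<Sum>b\<in>B. c b *\<^sub>R b))"
    using orbit_lower_bound by blast
  define M where "M = 1 + (\<Sum>b\<in>B. norm b)"
  have M: "M > 0" unfolding M_def by (simp add: add_pos_nonneg sum_nonneg)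
  have "(m / M) * norm y \<le> norm (\<phi> t y)" if t: "t \<ge> 0" and y: "y \<in> span B" for t y
  proof -
    obtain c where c: "y = (\<Sum>b\<in>B. c b *\<^sub>R b)" using y fin by (auto simp: span_finite)
    have "norm y \<le> (\<Sum>b\<in>B. \<bar>c b\<bar> * norm b)" unfolding c by (rule sum_norm_le) simp
    also have "\<dots> \<le> (\<Sum>b\<in>B. \<bar>c b\<bar> * M)"
    proof (intro sum_mono mult_left_mono)
      fix b assume "b \<in> B"
      then have "norm b \<le> (\<Sum>b\<in>B. norm b)" using fin by (intro member_le_sum) auto
      then show "norm b \<le> M" by (simp add: M_def)
    qed simp
    finally have "m * norm y \<le> (m * (\<Sum>b\<in>B. \<bar>c b\<bar>)) * M"
      using m(1) by (simp add: sum_distrib_right mult_left_mono mult.assoc)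
    also have "\<dots> \<le> norm (\<phi> t y) * M" using m(2)[OF t] M c by (simp add: mult_right_mono)
    finally show ?thesis using M by (simp add: field_simps)
  qed
  then show ?thesis using m(1) M by (intro exI[of _ "m / M"]) auto
qed

lemma bounded_coordinates:
  "\<exists>K>0. \<forall>c. \<forall>b\<in>B. \<bar>c b\<bar> \<le> K * norm (\<Sum>b\<in>B. c b *\<^sub>R b)"
proof -
  obtain m where m: "m > 0" "\<And>t c. t \<ge> 0 \<Longrightarrow> m * (\<Sum>b\<in>B. \<bar>c b\<bar>) \<le> norm (\<phi> t (\<Sum>b\<in>B. c b *\<^sub>R b))"
    using orbit_lower_bound by blast
  have "\<bar>c b\<bar> \<le> (C / m) * norm (\<Sum>b\<in>B. c b *\<^sub>R b)" if b: "b \<in> B" for c b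
  proof -
    have "m * \<bar>c b\<bar> \<le> m * (\<Sum>b\<in>B. \<bar>c b\<bar>)"
      using b fin m(1) by (intro mult_left_mono member_le_sum) auto
    also have "\<dots> \<le> C * norm (\<Sum>b\<in>B. c b *\<^sub>R b)"
      using m(2)[of 0 c] bound[of 0 "\<Sum>b\<in>B. c b *\<^sub>R b"] by simp
    finally show ?thesis using m(1) by (simp add: field_simps)
  qed
  then show ?thesis using C_pos m(1) by (intro exI[of _ "C / m"]) auto
qed

text \<open>
  The uniform transversality of \<open>Y\<^sub>t\<close> and \<open>X0\<close>: running the semigroup for a long further time \<open>s\<close>
  kills \<open>z\<close>, while \<open>\<phi> (s + t) y\<close> remains of size at least \<open>m * norm y\<close>. The constant does not
  depend on \<open>t\<close>, which is what bounds all the projections \<open>Q t\<close> at once.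
\<close>
lemma transversality:
  "\<exists>M>0. \<forall>t\<ge>0. \<forall>y\<in>span B. \<forall>z\<in>X0. norm y \<le> M * norm (\<phi> t y + z)"
proof -
  obtain m where m: "m > 0" "\<And>t y. t \<ge> 0 \<Longrightarrow> y \<in> span B \<Longrightarrow> m * norm y \<le> norm (\<phi> t y)"
    using orbit_lower_bound_norm by blast
  have "norm y \<le> (C / m) * norm (\<phi> t y + z)" if t: "t \<ge> 0" and y: "y \<in> span B" and z: "z \<in> X0" for t y z
  proof -
    have "((\<lambda>s. m * norm y - norm (\<phi> s z)) \<longlongrightarrow> m * norm y - norm (0::'a)) at_top"
      by (intro tendsto_intros X0D[OF z])
    moreover have "\<forall>\<^sub>F s in at_top. m * norm y - norm (\<phi> s z) \<le> C * norm (\<phi> t y + z)"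
      using eventually_ge_at_top[of 0]
    proof eventually_elim
      case (elim s)
      have "m * norm y \<le> norm (\<phi> s (\<phi> t y))" using m(2)[of "s + t" y] elim t y semigroup by simp
      also have "\<dots> \<le> norm (\<phi> s (\<phi> t y + z)) + norm (\<phi> s z)"
        by (metis add_diff_cancel_right' blinfun.add_right norm_triangle_ineq4)
      finally show ?case using bound[OF elim, of "\<phi> t y + z"] by linarith
    qed
    ultimately have "m * norm y - norm (0::'a) \<le> C * norm (\<phi> t y + z)"
      by (rule tendsto_upperbound) simp
    then show ?thesis using m(1) by (simp add: field_simps)
  qed
  then show ?thesis using C_pos m(1) by (intro exI[of _ "C / m"]) auto
qed

lemma subspace_Yt: "subspace (Yt t)"
  by (intro linear_subspace_image bounded_linear.linear blinfun.bounded_linear_right subspace_span)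

text \<open>
  With \<open>P\<close> the projection onto \<open>span B\<close> along \<open>X0\<close>, the map \<open>P \<circ> \<phi> t\<close> of \<open>span B\<close> to itself is
  injective, because \<open>\<phi> t x \<in> X0\<close> forces \<open>x \<in> X0\<close>. By finite dimension it is onto, so every
  coset of \<open>X0\<close> meets \<open>Y\<^sub>t\<close>.
\<close>
lemma direct_sum_Yt:
  assumes t: "t \<ge> 0"
  shows "direct_sum X0 (Yt t)"
proof -
  obtain P :: "'a \<Rightarrow> 'a" where P: "linear P" "\<And>x. P x \<in> span B" "\<And>x. x - P x \<in> X0"
    using direct_sum_projection[OF sum] by blast
  have P0: "x \<in> X0 \<longleftrightarrow> P x = 0" for x
  proof
    assume "x \<in> X0"
    then have "P x \<in> X0" using P(3)[of x] subspace_X0 by (metis add_diff_cancel_left' diff_diff_eq2 subspace_diff)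
    then show "P x = 0" using X0_inter P(2) by blast
  qed (use P(3)[of x] in simp)
  have lin: "linear (\<phi> t)" by (intro bounded_linear.linear blinfun.bounded_linear_right)
  have T: "linear (P \<circ> \<phi> t)" using lin P(1) by (rule linear_compose)
  have inj: "inj_on (P \<circ> \<phi> t) (span B)"
    unfolding linear_inj_on_iff_eq_0[OF T subspace_span]
    using P0 X0_invariant[OF t] X0_inter by auto
  have onto: "(P \<circ> \<phi> t) ` span B = span B"
    by (rule independent_image_spans[OF fin ind T inj]) (use P(2) in auto)
  have "\<exists>a\<in>X0. \<exists>b\<in>Yt t. x = a + b" for x
  proof -
    obtain u where u: "u \<in> span B" "P x = P (\<phi> t u)" using onto P(2)[of x] by auto
    then have "x - \<phi> t u \<in> X0" using P0 linear_diff[OF P(1)] by simp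
    then show ?thesis using u(1) by (intro bexI[of _ "x - \<phi> t u"] bexI[of _ "\<phi> t u"]) auto
  qed
  then have "{a + b |a b. a \<in> X0 \<and> b \<in> Yt t} = UNIV" by blast
  moreover have "X0 \<inter> Yt t = {0}"
  proof -
    have "0 \<in> Yt t" using subspace_0[OF subspace_Yt] .
    moreover have "x = 0" if x: "x \<in> X0" "x \<in> Yt t" for x
    proof -
      obtain u where u: "u \<in> span B" "x = \<phi> t u" using x(2) by auto
      then have "u \<in> X0 \<inter> span B" using x(1) X0_invariant[OF t] by simp
      then show ?thesis unfolding X0_inter u(2) by simp
    qed
    ultimately show ?thesis using subspace_0[OF subspace_X0] by auto
  qed
  ultimately show ?thesis using subspace_X0 subspace_Yt by (simp add: direct_sum_def)
qed

section \<open>The projections onto the moving subspace\<close>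

text \<open>
  The projection onto \<open>Y\<^sub>t\<close> along \<open>X0\<close>. Because the kernel is the same for all \<open>t\<close>, the subspaces
  \<open>Y\<^sub>t\<close> are encoded by operators that can be subtracted from each other.
\<close>
definition Q :: "real \<Rightarrow> 'a \<Rightarrow> 'a" where
  "Q t = (SOME P. linear P \<and> (\<forall>x. P x \<in> Yt t \<and> x - P x \<in> X0))"

context
  fixes t :: real
  assumes t: "t \<ge> 0"
begin

lemma Q: "linear (Q t)" "Q t x \<in> Yt t" "x - Q t x \<in> X0"
proof -
  have "\<exists>P. linear P \<and> (\<forall>x. P x \<in> Yt t \<and> x - P x \<in> X0)"
    using direct_sum_projection[OF direct_sum_Yt[OF t]] by metis
  then have "linear (Q t) \<and> (\<forall>x. Q t x \<in> Yt t \<and> x - Q t x \<in> X0)"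
    unfolding Q_def by (rule someI_ex)
  then show "linear (Q t)" "Q t x \<in> Yt t" "x - Q t x \<in> X0" by auto
qed

lemma Q_unique:
  assumes "y \<in> Yt t" "x - y \<in> X0"
  shows "Q t x = y"
proof -
  have "(x - y) - (x - Q t x) \<in> X0" using subspace_diff[OF subspace_X0] assms Q(3) by blast
  then have "Q t x - y \<in> X0 \<inter> Yt t"
    using subspace_diff[OF subspace_Yt Q(2) assms(1)] by simp
  also have "\<dots> = {0}" using direct_sum_Yt[OF t] by (simp add: direct_sum_def)
  finally show ?thesis by simp
qed

lemma Q_cong: "x - y \<in> X0 \<Longrightarrow> Q t x = Q t y"
  by (intro Q_unique Q) (metis Q(3) subspace_X0 subspace_add diff_add_cancel add_diff_eq)

lemma Q_eq_0_iff: "Q t x = 0 \<longleftrightarrow> x \<in> X0"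
proof
  show "Q t x = 0 \<Longrightarrow> x \<in> X0" using Q(3)[of x] by simp
  show "x \<in> X0 \<Longrightarrow> Q t x = 0"
    by (rule Q_unique) (auto simp: subspace_0[OF subspace_Yt])
qed

lemma Q_fixes: "y \<in> Yt t \<Longrightarrow> Q t y = y"
  by (rule Q_unique) (auto simp: subspace_0[OF subspace_X0])

lemma Q_semigroup:
  assumes s: "s \<ge> 0"
  shows "Q (s + t) (\<phi> s x) = \<phi> s (Q t x)"
proof -
  obtain y where y: "y \<in> span B" "Q t x = \<phi> t y" using Q(2)[of x] by auto
  have "\<phi> s x - \<phi> s (Q t x) \<in> X0"
    using X0_invariant[OF s, of "x - Q t x"] Q(3) by (simp add: blinfun.diff_right)
  moreover have "\<phi> s (Q t x) \<in> Yt (s + t)"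
    using y semigroup s t by auto
  ultimately show ?thesis
    using complemented_semigroup.Q_unique[OF complemented_semigroup_axioms, of "s + t"] s t by simp
qed

end

lemma Q_bound:
  "\<exists>M>0. \<forall>t\<ge>0. \<forall>x. norm (Q t x) \<le> M * norm x \<and>
     (\<exists>y\<in>span B. Q t x = \<phi> t y \<and> norm y \<le> M * norm x)"
proof -
  obtain M where M: "M > 0"
      "\<And>t y z. t \<ge> 0 \<Longrightarrow> y \<in> span B \<Longrightarrow> z \<in> X0 \<Longrightarrow> norm y \<le> M * norm (\<phi> t y + z)"
    using transversality by blast
  have "norm (Q t x) \<le> max M (C * M) * norm x \<and>
     (\<exists>y\<in>span B. Q t x = \<phi> t y \<and> norm y \<le> max M (C * M) * norm x)" if t: "t \<ge> 0" for t x
  proof -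
    obtain y where y: "y \<in> span B" "Q t x = \<phi> t y" using Q(2)[OF t, of x] by auto
    have le: "norm y \<le> M * norm x" using M(2)[OF t y(1) Q(3)[OF t, of x]] y(2) by simp
    have "norm (Q t x) \<le> C * norm y" using bound[OF t] y(2) by simp
    also have "\<dots> \<le> C * M * norm x" using le C_pos by simp
    also have "\<dots> \<le> max M (C * M) * norm x" by (intro mult_right_mono) auto
    finally have "norm (Q t x) \<le> max M (C * M) * norm x" .
    moreover have "norm y \<le> max M (C * M) * norm x"
      by (rule order_trans[OF le]) (intro mult_right_mono, auto)
    ultimately show ?thesis using y by blast
  qed
  then show ?thesis using M(1) by (intro exI[of _ "max M (C * M)"]) auto
qed

lemma bounded_linear_Q: "t \<ge> 0 \<Longrightarrow> bounded_linear (Q t)"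
proof -
  assume t: "t \<ge> 0"
  obtain M where "\<And>x. norm (Q t x) \<le> M * norm x" using Q_bound t by blast
  then show ?thesis
    by (intro bounded_linear_intro[of _ M])
      (simp_all add: linear_add[OF Q(1)[OF t]] linear_scale[OF Q(1)[OF t]] mult.commute)
qed

text \<open>
  Both one-sided distances bound the difference of the projections, so their minimum does too:
  \<open>Q s - Q t\<close> is symmetric in \<open>s\<close> and \<open>t\<close> up to sign, while each one-sided distance controls how
  far \<open>Q s\<close> moves a vector of \<open>Y\<^sub>t\<close>, hence \<open>Q s (Q t x) - Q t x = Q s x - Q t x\<close>.
\<close>
lemma Q_diff_le_angle:
  "\<exists>K>0. \<forall>s\<ge>0. \<forall>t\<ge>0. \<forall>x. norm (Q s x - Q t x) \<le> K * angle (Yt s) (Yt t) * norm x"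
proof -
  obtain M where M: "M > 0" "\<And>t x. t \<ge> 0 \<Longrightarrow> norm (Q t x) \<le> M * norm x"
    using Q_bound by blast
  define K where "K = (M + 1) * M"
  have one_sided: "norm (Q s x - Q t x) \<le> K * max_dist (Yt t) (Yt s) * norm x"
    if s: "s \<ge> 0" and t: "t \<ge> 0" for s t x
  proof -
    let ?a = "Q t x"
    have Qa: "Q s ?a = Q s x" by (rule Q_cong[OF s Q(3)[OF t], symmetric])
    have "norm (Q s ?a - ?a) / (M + 1) \<le> dist ?a b" if b: "b \<in> Yt s" for b
    proof -
      have "Q s ?a - ?a = Q s (?a - b) - (?a - b)"
        using Q_fixes[OF s b] linear_diff[OF Q(1)[OF s]] by simp
      then have "norm (Q s ?a - ?a) \<le> norm (Q s (?a - b)) + norm (?a - b)"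
        by (metis norm_triangle_ineq4)
      also have "\<dots> \<le> (M + 1) * norm (?a - b)"
        using M(2)[OF s, of "?a - b"] by (simp add: distrib_right)
      finally show ?thesis using M(1) by (simp add: dist_norm pos_divide_le_eq mult.commute)
    qed
    then have "norm (Q s ?a - ?a) / (M + 1) \<le> infdist ?a (Yt s)"
      using subspace_0[OF subspace_Yt[of s]] unfolding infdist_def by (auto intro: cINF_greatest)
    also have "\<dots> \<le> max_dist (Yt t) (Yt s) * norm ?a"
      by (rule infdist_le_max_dist[OF subspace_Yt subspace_Yt Q(2)[OF t]])
    also have "\<dots> \<le> max_dist (Yt t) (Yt s) * (M * norm x)"
      using M(2)[OF t] by (intro mult_left_mono max_dist_nonneg subspace_Yt)
    finally show ?thesis
      using M(1) unfolding Qa K_def by (simp add: pos_divide_le_eq mult_ac)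
  qed
  have "norm (Q s x - Q t x) \<le> K * angle (Yt s) (Yt t) * norm x"
    if s: "s \<ge> 0" and t: "t \<ge> 0" for s t x
    using one_sided[OF s t, of x] one_sided[OF t s, of x]
    by (auto simp: angle_def min_def norm_minus_commute)
  moreover have "K > 0" using M(1) by (simp add: K_def)
  ultimately show ?thesis by blast
qed

text \<open>
  Every \<open>x\<close> is, modulo \<open>X0\<close>, the image at any late time \<open>k\<close> of some \<open>y \<in> span B\<close> of bounded norm.
  Hence \<open>D x = D (\<phi> k y) = \<phi> k (D y)\<close>, and since \<open>D\<close> maps the bounded set of all such \<open>y\<close> to a
  bounded set in a finite-dimensional subspace of \<open>X0\<close>, the right-hand side tends to 0. This
  is applied to the commutator of \<open>\<phi> s\<close> for fractional \<open>s\<close> with the limit projection, which is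
  known at first to commute with \<open>\<phi>\<close> only at integer times.
\<close>
lemma commuting_defect_zero:
  assumes D: "linear D" "\<And>x. D x \<in> X0" "\<And>x. x \<in> X0 \<Longrightarrow> D x = 0"
    and comm: "\<And>k x. D (\<phi> (real k) x) = \<phi> (real k) (D x)"
  shows "D x = 0"
proof -
  obtain M where M: "M > 0"
      "\<And>t x. t \<ge> 0 \<Longrightarrow> \<exists>y\<in>span B. Q t x = \<phi> t y \<and> norm y \<le> M * norm x"
    using Q_bound by blast
  obtain K where K: "K > 0" "\<And>c b. b \<in> B \<Longrightarrow> \<bar>c b\<bar> \<le> K * norm (\<Sum>b\<in>B. c b *\<^sub>R b)"
    using bounded_coordinates by blast
  define E where "E = K * (M * norm x)"
  define g where "g k = (\<Sum>b\<in>B. E * norm (\<phi> (real k) (D b)))" for k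
  have "norm (D x) \<le> g k" for k
  proof -
    obtain y where y: "y \<in> span B" "Q (real k) x = \<phi> (real k) y" "norm y \<le> M * norm x"
      using M(2)[of "real k" x] by auto
    obtain c where c: "y = (\<Sum>b\<in>B. c b *\<^sub>R b)" using y(1) fin by (auto simp: span_finite)
    have cE: "\<bar>c b\<bar> \<le> E" if "b \<in> B" for b
      unfolding E_def using K(2)[OF that, of c] y(3) K(1) unfolding c[symmetric]
      by (meson mult_left_mono less_imp_le order_trans)
    have "D x - D (Q (real k) x) = D (x - Q (real k) x)" by (simp add: linear_diff[OF D(1)])
    also have "\<dots> = 0" by (intro D(3) Q) simp
    finally have "D x = \<phi> (real k) (D y)" by (simp add: y(2) comm)
    also have "\<dots> = (\<Sum>b\<in>B. c b *\<^sub>R \<phi> (real k) (D b))"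
      unfolding c by (simp add: linear_sum[OF D(1)] linear_scale[OF D(1)] blinfun.sum_right blinfun.scaleR_right)
    also have "norm \<dots> \<le> g k"
      unfolding g_def by (intro sum_norm_le) (simp add: cE mult_right_mono)
    finally show ?thesis .
  qed
  moreover have "g \<longlonglongrightarrow> 0"
  proof -
    have "(\<lambda>k. \<phi> (real k) (D b)) \<longlonglongrightarrow> 0" for b
      by (rule filterlim_compose[OF X0D[OF D(2)] filterlim_real_sequentially])
    then have "g \<longlonglongrightarrow> (\<Sum>b\<in>B. E * norm (0::'a))"
      unfolding g_def by (intro tendsto_intros)
    then show ?thesis by simp
  qed
  ultimately have "norm (D x) \<le> 0"
    by (intro tendsto_lowerbound[of g 0 sequentially]) auto
  then show ?thesis by simp
qed

lemma angle_Yt_nonneg: "subspace Z \<Longrightarrow> 0 \<le> angle (Yt t) Z"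
  unfolding angle_def by (simp add: max_dist_nonneg subspace_Yt)

section \<open>Summable angles imply a limit position\<close>

text \<open>
  The limit position is the range of the pointwise limit \<open>L\<close> of the projections at integer times.
  The quantitative form \<open>norm (L x - R k x) \<le> K * (l - S k) * norm x\<close> is kept because it is uniform
  in \<open>x\<close>. That uniformity passes to fractional times by applying \<open>\<phi> s\<close>, which maps the range of
  \<open>L\<close> into itself.
\<close>
lemma stabilizable_if_angle_sums_converge:
  defines "S \<equiv> \<lambda>N. \<Sum>k=1..N. angle (Yt (real (k + 1))) (Yt (real k))"
  assumes S: "S \<longlonglongrightarrow> l" "\<And>N. S N \<le> l"
  shows "stabilizable \<phi> (card B) (span B)"
proof -
  obtain K where K: "K > 0"
      "\<And>s t x. s \<ge> 0 \<Longrightarrow> t \<ge> 0 \<Longrightarrow> norm (Q s x - Q t x) \<le> K * angle (Yt s) (Yt t) * norm x"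
    using Q_diff_le_angle by blast
  obtain m where m: "m > 0" "\<And>t y. t \<ge> 0 \<Longrightarrow> y \<in> span B \<Longrightarrow> m * norm y \<le> norm (\<phi> t y)"
    using orbit_lower_bound_norm by blast
  \<comment> \<open>The shift by 1 matches the sum, whose first term compares the times 2 and 1.\<close>
  define R where "R N = Q (real (N + 1))" for N
  have R_diff: "norm (R N x - R k x) \<le> K * (S N - S k) * norm x" if "k \<le> N" for k N x
    using that
  proof (induction rule: dec_induct)
    case (step N)
    have "norm (R (Suc N) x - R N x) \<le> K * angle (Yt (real (Suc N + 1))) (Yt (real (N + 1))) * norm x"
      unfolding R_def by (intro K) auto
    also have "\<dots> = K * (S (Suc N) - S N) * norm x" by (simp add: S_def)
    finally have "norm (R (Suc N) x - R k x) \<le> K * (S (Suc N) - S N) * norm x + K * (S N - S k) * norm x"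
      using step.IH norm_triangle_ineq[of "R (Suc N) x - R N x" "R N x - R k x"] by simp
    then show ?case by (simp add: algebra_simps)
  qed simp
  have R_diff': "norm (R N x - R k x) \<le> K * (l - S k) * norm x" if "k \<le> N" for k N x
  proof -
    have "K * (S N - S k) * norm x \<le> K * (l - S k) * norm x"
      using S(2)[of N] K(1) by (intro mult_right_mono mult_left_mono) auto
    with R_diff[OF that, of x] show ?thesis by linarith
  qed
  have tail: "(\<lambda>k. c * (l - S k)) \<longlonglongrightarrow> 0" for c
  proof -
    have "(\<lambda>k. c * (l - S k)) \<longlonglongrightarrow> c * (l - l)" by (intro tendsto_intros S)
    then show ?thesis by simp
  qed
  have "Cauchy (\<lambda>N. R N x)" for x
  proof (rule CauchyI')
    fix e :: real assume "e > 0"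
    with tail[of "K * norm x"] have "\<forall>\<^sub>F k in sequentially. K * norm x * (l - S k) < e"
      by (rule order_tendstoD)
    then obtain N0 where N0: "\<And>k. k \<ge> N0 \<Longrightarrow> K * norm x * (l - S k) < e"
      by (auto simp: eventually_sequentially)
    have "dist (R i x) (R j x) < e" if "i \<ge> N0" "j > i" for i j
      using R_diff'[of i j x] N0[of i] that by (simp add: dist_norm norm_minus_commute mult_ac)
    then show "\<exists>M. \<forall>m\<ge>M. \<forall>n>m. dist (R m x) (R n x) < e" by blast
  qed
  then have "convergent (\<lambda>N. R N x)" for x by (rule Cauchy_convergent)
  then have L: "(\<lambda>N. R N x) \<longlonglongrightarrow> lim (\<lambda>N. R N x)" for x
    by (simp add: convergent_LIMSEQ_iff)
  define L where "L x = lim (\<lambda>N. R N x)" for x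
  note L = L[folded L_def]
  have L_diff: "norm (L x - R k x) \<le> K * (l - S k) * norm x" for k x
  proof (rule tendsto_upperbound)
    show "(\<lambda>N. norm (R N x - R k x)) \<longlonglongrightarrow> norm (L x - R k x)" by (intro tendsto_intros L)
    show "\<forall>\<^sub>F N in sequentially. norm (R N x - R k x) \<le> K * (l - S k) * norm x"
      using eventually_ge_at_top[of k] by eventually_elim (rule R_diff')
  qed simp
  have R: "linear (R N)" for N unfolding R_def by (intro Q) simp
  have lin: "linear L"
  proof
    fix x y r
    have "(\<lambda>N. R N (x + y)) \<longlonglongrightarrow> L x + L y"
      unfolding linear_add[OF R] by (intro tendsto_intros L)
    then show "L (x + y) = L x + L y" using L LIMSEQ_unique by blast
    have "(\<lambda>N. R N (r *\<^sub>R x)) \<longlonglongrightarrow> r *\<^sub>R L x"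
      unfolding linear_scale[OF R] by (intro tendsto_intros L)
    then show "L (r *\<^sub>R x) = r *\<^sub>R L x" using L LIMSEQ_unique by blast
  qed
  \<comment> \<open>The projection \<open>Q 1\<close> is continuous with kernel \<open>X0\<close>, so it carries membership in \<open>X0\<close> to the limit.\<close>
  have L_mod: "x - L x \<in> X0" for x
  proof -
    have "Q 1 (R N x) = Q 1 x" for N
      unfolding R_def by (rule Q_cong[symmetric]) (auto intro: Q)
    moreover have "(\<lambda>N. Q 1 (R N x)) \<longlonglongrightarrow> Q 1 (L x)"
      by (intro bounded_linear.tendsto[OF bounded_linear_Q] L) simp
    ultimately have "Q 1 (x - L x) = 0"
      by (simp add: linear_diff[OF Q(1)] LIMSEQ_const_iff)
    then show ?thesis by (simp add: Q_eq_0_iff)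
  qed
  have L_X0: "L x = 0 \<longleftrightarrow> x \<in> X0" for x
  proof
    show "x \<in> X0" if "L x = 0" using L_mod[of x] that by simp
    assume "x \<in> X0"
    then have "R N x = 0" for N unfolding R_def by (subst Q_eq_0_iff) auto
    then show "L x = 0" using L[of x] by (simp add: LIMSEQ_const_iff)
  qed
  have L_comm_nat: "\<phi> (real k) (L x) = L (\<phi> (real k) x)" for k x
  proof -
    have "R (N + k) (\<phi> (real k) x) = \<phi> (real k) (R N x)" for N
      using Q_semigroup[of "real (N + 1)" "real k" x] by (simp add: R_def algebra_simps)
    moreover have "(\<lambda>N. R (N + k) (\<phi> (real k) x)) \<longlonglongrightarrow> L (\<phi> (real k) x)"
      by (intro LIMSEQ_ignore_initial_segment L)
    moreover have "(\<lambda>N. \<phi> (real k) (R N x)) \<longlonglongrightarrow> \<phi> (real k) (L x)"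
      by (intro tendsto_intros L)
    ultimately show ?thesis using LIMSEQ_unique by simp
  qed
  have L_comm: "\<phi> s (L x) = L (\<phi> s x)" if s: "s \<ge> 0" for s x
  proof -
    define D where "D x = \<phi> s (L x) - L (\<phi> s x)" for x
    have "D x = 0"
    proof (rule commuting_defect_zero[of D])
      show "linear D"
        by (rule linearI) (simp_all add: D_def linear_add[OF lin] linear_scale[OF lin] blinfun.add_right
            blinfun.scaleR_right scaleR_diff_right)
      show "D x \<in> X0" for x
      proof -
        have "\<phi> s (x - L x) \<in> X0" using X0_invariant[OF s] L_mod by simp
        then have "(\<phi> s x - L (\<phi> s x)) - \<phi> s (x - L x) \<in> X0"
          using subspace_diff[OF subspace_X0] L_mod by blast
        then show ?thesis by (simp add: D_def blinfun.diff_right)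
      qed
      show "D x = 0" if x: "x \<in> X0" for x
      proof -
        have "L x = 0" using x by (simp only: L_X0)
        moreover have "L (\<phi> s x) = 0" using x X0_invariant[OF s] by (simp only: L_X0)
        ultimately show ?thesis by (simp add: D_def)
      qed
      show "D (\<phi> (real k) x) = \<phi> (real k) (D x)" for k x
      proof -
        have comm: "\<phi> s (\<phi> (real k) z) = \<phi> (real k) (\<phi> s z)" for z
          using semigroup s by (metis add.commute of_nat_0_le_iff)
        show ?thesis
          unfolding D_def blinfun.diff_right comm L_comm_nat comm[of "L x", symmetric]
          by (simp add: comm L_comm_nat[symmetric])
      qed
    qed
    then show ?thesis by (simp add: D_def)
  qed
  define Z where "Z = range L"
  have subspace_Z: "subspace Z"
    unfolding Z_def by (intro linear_subspace_image lin subspace_UNIV)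
  have dim_Z: "subspace_of_dim (card B) Z"
  proof -
    have inj: "inj_on L (span B)"
      unfolding linear_inj_on_iff_eq_0[OF lin subspace_span] L_X0 using X0_inter by blast
    have "Z = L ` span B"
    proof
      show "Z \<subseteq> L ` span B"
      proof
        fix z assume "z \<in> Z"
        then obtain x where x: "z = L x" by (auto simp: Z_def)
        have "x \<in> {a + b |a b. a \<in> X0 \<and> b \<in> span B}" using sum by (simp add: direct_sum_def)
        then obtain a b where ab: "x = a + b" "a \<in> X0" "b \<in> span B" by blast
        then have "z = L b" using L_X0 by (simp add: x linear_add[OF lin])
        then show "z \<in> L ` span B" using ab(3) by blast
      qed
    qed (auto simp: Z_def)
    then have "span (L ` B) = Z" by (simp add: linear_span_image[OF lin])
    moreover have "card (L ` B) = card B"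
      using inj span_superset by (metis card_image inj_on_subset)
    ultimately show ?thesis
      unfolding subspace_of_dim_def
      using fin linear_independent_injective_image[OF lin ind inj] by blast
  qed
  define E where "E = C * K * (C / m)"
  have E: "E > 0" using C_pos K(1) m(1) by (simp add: E_def)
  \<comment> \<open>Write \<open>t = s + (k + 1)\<close> with \<open>s \<ge> 0\<close>; a vector of \<open>Y\<^sub>t\<close> is then \<open>\<phi> s u\<close> with \<open>R k u = u\<close>,
    and \<open>\<phi> s (L u)\<close> is the nearby vector of \<open>Z\<close>.\<close>
  have angle_le: "angle (Yt t) Z \<le> E * (l - S (nat \<lfloor>t\<rfloor> - 1))" if t: "t \<ge> 1" for t
  proof -
    define k where "k = nat \<lfloor>t\<rfloor> - 1"
    have "1 \<le> nat \<lfloor>t\<rfloor>" using t by (simp add: le_nat_floor)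
    then have k: "real (k + 1) \<le> t" unfolding k_def using t by (simp add: of_nat_floor)
    define s where "s = t - real (k + 1)"
    have s: "s \<ge> 0" using k by (simp add: s_def)
    have "max_dist (Yt t) Z \<le> E * (l - S k)"
    proof (rule max_dist_le)
      show "0 \<le> E * (l - S k)" using E S(2)[of k] by simp
      fix a assume "a \<in> Yt t" and a1: "norm a = 1"
      then obtain y where y: "y \<in> span B" "a = \<phi> t y" by auto
      define u where "u = \<phi> (real (k + 1)) y"
      have u: "R k u = u" unfolding R_def u_def by (rule Q_fixes) (use y in auto)
      have au: "a = \<phi> s u"
        using semigroup[of s "real (k + 1)" y] s y(2) by (simp add: u_def s_def)
      have "m * norm y \<le> 1" using m(2)[of t y] t y a1 by simp
      then have "norm y \<le> 1 / m" using m(1) by (simp add: field_simps)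
      then have "C * norm y \<le> C * (1 / m)" using C_pos by (intro mult_left_mono) auto
      moreover have "norm u \<le> C * norm y" unfolding u_def by (rule bound) simp
      ultimately have nu: "norm u \<le> C / m" by simp
      have "norm (a - \<phi> s (L u)) = norm (\<phi> s (u - L u))" by (simp add: au blinfun.diff_right)
      also have "\<dots> \<le> C * norm (u - L u)" by (rule bound[OF s])
      also have "\<dots> \<le> C * (K * (l - S k) * norm u)"
        using L_diff[of u k] C_pos u by (intro mult_left_mono) (auto simp: norm_minus_commute)
      also have "\<dots> \<le> C * (K * (l - S k) * (C / m))"
        using nu S(2)[of k] K(1) C_pos by (intro mult_left_mono) auto
      also have "\<dots> = E * (l - S k)" by (simp add: E_def)
      finally have "norm (a - \<phi> s (L u)) \<le> E * (l - S k)" .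
      moreover have "\<phi> s (L u) \<in> Z" unfolding L_comm[OF s] Z_def by blast
      ultimately show "\<exists>b\<in>Z. norm (a - b) \<le> E * (l - S k)" by blast
    qed
    then show ?thesis by (simp add: angle_def k_def min.coboundedI1)
  qed
  have floor_lim: "filterlim (\<lambda>t::real. nat \<lfloor>t\<rfloor> - 1) sequentially at_top"
    unfolding filterlim_at_top
  proof
    fix n
    show "\<forall>\<^sub>F t::real in at_top. n \<le> nat \<lfloor>t\<rfloor> - 1"
      using eventually_ge_at_top[of "real (n + 1)"]
    proof eventually_elim
      case (elim t)
      then have "n + 1 \<le> nat \<lfloor>t\<rfloor>" by (rule le_nat_floor)
      then show ?case by simp
    qed
  qed
  have lim: "((\<lambda>t::real. E * (l - S (nat \<lfloor>t\<rfloor> - 1))) \<longlongrightarrow> 0) at_top"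
    by (rule filterlim_compose[OF tail[of E] floor_lim])
  have "((\<lambda>t. angle (Yt t) Z) \<longlongrightarrow> 0) at_top"
  proof (rule tendsto_sandwich[OF _ _ tendsto_const lim])
    show "\<forall>\<^sub>F t in at_top. 0 \<le> angle (Yt t) Z" by (simp add: angle_Yt_nonneg subspace_Z)
    show "\<forall>\<^sub>F t in at_top. angle (Yt t) Z \<le> E * (l - S (nat \<lfloor>t\<rfloor> - 1))"
      using eventually_ge_at_top[of 1] by eventually_elim (rule angle_le)
  qed
  then show ?thesis using dim_Z by (auto simp: stabilizable_def)
qed

end

theorem mainTheorem6:
  fixes \<phi> :: "real \<Rightarrow> 'a::banach \<Rightarrow>\<^sub>L 'a" and n :: nat and Y :: "'a set"
  assumes "bounded_semigroup \<phi>"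
    and "\<And>v. continuous_on {0<..} (\<lambda>t. blinfun_apply (\<phi> t) v)"
    and "has_codim (null_space \<phi>) n"
    and "subspace_of_dim n Y"
    and "direct_sum (null_space \<phi>) Y"
    and "\<not> stabilizable \<phi> n Y"
  shows "filterlim
     (\<lambda>N. \<Sum>k=1..N. angle (blinfun_apply (\<phi> (real (k + 1))) ` Y) (blinfun_apply (\<phi> (real k)) ` Y))
     at_top sequentially"
proof (rule ccontr)
  let ?S = "\<lambda>N. \<Sum>k=1..N. angle (\<phi> (real (k + 1)) ` Y) (\<phi> (real k) ` Y)"
  assume diverges: "\<not> filterlim ?S at_top sequentially"
  obtain B where B: "finite B" "card B = n" "independent B" "span B = Y"
    using assms(4) by (auto simp: subspace_of_dim_def)
  obtain C where C: "\<And>t. t \<ge> 0 \<Longrightarrow> norm (\<phi> t) \<le> C"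
    and comp: "\<And>s t. s \<ge> 0 \<Longrightarrow> t \<ge> 0 \<Longrightarrow> \<phi> s o\<^sub>L \<phi> t = \<phi> (s + t)"
    using assms(1) by (auto simp: bounded_semigroup_def)
  interpret complemented_semigroup \<phi> B "max C 1"
  proof
    show "\<phi> (s + t) x = \<phi> s (\<phi> t x)" if "s \<ge> 0" "t \<ge> 0" for s t x
      using comp[OF that, symmetric] by simp
    show "norm (\<phi> t x) \<le> max C 1 * norm x" if "t \<ge> 0" for t x
    proof -
      have "norm (\<phi> t x) \<le> norm (\<phi> t) * norm x" by (rule norm_blinfun)
      also have "\<dots> \<le> max C 1 * norm x" using C[OF that] by (intro mult_right_mono) auto
      finally show ?thesis .
    qed
  qed (use B assms(5) in auto)
  have "incseq ?S"
    unfolding B(4)[symmetric]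
    by (rule incseq_SucI) (simp add: angle_Yt_nonneg subspace_Yt)
  then obtain l where "?S \<longlonglongrightarrow> l" "\<And>N. ?S N \<le> l"
    using incseq_convergent_or_at_top diverges by blast
  then have "stabilizable \<phi> (card B) (span B)"
    unfolding B(4)[symmetric] by (rule stabilizable_if_angle_sums_converge)
  then show False using assms(6) B by simp
qed

end
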